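(* Let $\{F_n\}_{n\geq 0}$ be a sequence of positive integers with $F_0=1$, let $V=\bigcup_{s\geq 0}\Phi_s$ with $\Phi_s=\{\langle j,s\rangle : 1\leq j\leq F_s\}$, and let $\Pi=(V,\leq)$ be the cobweb poset, where for $\langle s,t\rangle,\langle u,v\rangle\in V$, $$\langle s,t\rangle\leq\langle u,v\rangle \iff (t<v)\ \vee\ (t=v\ \wedge\ s=u),$$ whose Hasse diagram is the digraph $(V,E)$ with $E=\{(\langle j,p\rangle,\langle q,p+1\rangle) : p\geq 0,\ 1\leq j\leq F_p,\ 1\leq q\leq F_{p+1}\}$. Define two relations $X$ and $Y$ on $V$ by $$\langle s,t\rangle\leq_X\langle u,v\rangle \iff (t<v)\ \vee\ (t=v\ \wedge\ s\leq u),$$ $$\langle s,t\rangle\leq_Y\langle u,v\rangle \iff (t<v)\ \vee\ (t=v\ \wedge\ s\geq u).$$ Then $X$ and $Y$ are linear extensions of $\leq$, and $\leq\,=X\cap Y$ (as sets of ordered pairs). Consequently, the cobweb poset digraph $\Pi$ is an orderable directed acyclic graph (oDAG).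
   Context: A linear extension of a partial order $P$ on a set $A$ is a linear order $L$ on $A$ with $a\leq_P b\Rightarrow a\leq_L b$. The dimension of a partial order $R$ is the least $s$ such that $R$ is the intersection of $s$ linear extensions of $R$. A directed acyclic graph without loops and multiple edges is called orderable (oDAG) if there exists a poset of dimension $2$ whose Hasse diagram coincides with the digraph.
   Formalization: The oDAG conclusion is proved when some F_n differs from 1; if all F_n = 1, the digraph is an infinite path whose only poset is a chain of dimension 1, so the claim fails there. All other conclusions, and dimension at most 2, hold for every F. *)

theory Defs
  imports Main
begin

text \<open>Orders on a carrier \<open>A\<close> are sets of pairs, as in \<open>HOL.Order_Relation\<close>;
  \<open>(a, b) \<in> R\<close> means \<open>a \<le> b\<close>.\<close>

definition linear_extension :: "'a set \<Rightarrow> 'a rel \<Rightarrow> 'a rel \<Rightarrow> bool" where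
  "linear_extension A R L \<longleftrightarrow> linear_order_on A L \<and> R \<subseteq> L"

text \<open>The empty intersection is read relative to \<open>A\<close>, so it is \<open>A \<times> A\<close>.\<close>

definition intersection_of_linear_extensions :: "'a set \<Rightarrow> 'a rel \<Rightarrow> nat \<Rightarrow> bool" where
  "intersection_of_linear_extensions A R s \<longleftrightarrow>
     (\<exists>\<L>. finite \<L> \<and> card \<L> = s \<and> (\<forall>L\<in>\<L>. linear_extension A R L) \<and> R = (A \<times> A) \<inter> \<Inter>\<L>)"

text \<open>A predicate rather than a function, since an infinite order need not be an intersection
  of finitely many linear extensions.\<close>

definition has_order_dimension :: "'a set \<Rightarrow> 'a rel \<Rightarrow> nat \<Rightarrow> bool" where
  "has_order_dimension A R s \<longleftrightarrow>
     intersection_of_linear_extensions A R s \<and>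
     (\<forall>t<s. \<not> intersection_of_linear_extensions A R t)"

definition hasse_edges :: "'a rel \<Rightarrow> 'a rel" where
  "hasse_edges R =
     {(a, b). (a, b) \<in> R \<and> a \<noteq> b \<and>
        \<not> (\<exists>c. c \<noteq> a \<and> c \<noteq> b \<and> (a, c) \<in> R \<and> (c, b) \<in> R)}"

text \<open>Edges form a set of ordered pairs, which rules out multiple edges; \<open>acyclic\<close> also
  rules out loops.\<close>

definition dag :: "'a set \<Rightarrow> 'a rel \<Rightarrow> bool" where
  "dag V E \<longleftrightarrow> E \<subseteq> V \<times> V \<and> acyclic E"

definition orderable_dag :: "'a set \<Rightarrow> 'a rel \<Rightarrow> bool" where
  "orderable_dag V E \<longleftrightarrow>
     dag V E \<and> (\<exists>R. partial_order_on V R \<and> has_order_dimension V R 2 \<and> hasse_edges R = E)"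

text \<open>The vertex \<open>\<langle>j, s\<rangle>\<close> is the pair \<open>(j, s)\<close>: position first, level second.\<close>

definition cobweb_level :: "(nat \<Rightarrow> nat) \<Rightarrow> nat \<Rightarrow> (nat \<times> nat) set" where
  "cobweb_level F s = {(j, s) | j. 1 \<le> j \<and> j \<le> F s}"

definition cobweb_verts :: "(nat \<Rightarrow> nat) \<Rightarrow> (nat \<times> nat) set" where
  "cobweb_verts F = (\<Union>s. cobweb_level F s)"

definition cobweb_order :: "(nat \<Rightarrow> nat) \<Rightarrow> (nat \<times> nat) rel" where
  "cobweb_order F =
     {((s, t), (u, v)) | s t u v. (s, t) \<in> cobweb_verts F \<and> (u, v) \<in> cobweb_verts F \<and>
        (t < v \<or> (t = v \<and> s = u))}"

definition cobweb_edges :: "(nat \<Rightarrow> nat) \<Rightarrow> (nat \<times> nat) rel" where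
  "cobweb_edges F =
     {((j, p), (q, p + 1)) | j p q. 1 \<le> j \<and> j \<le> F p \<and> 1 \<le> q \<and> q \<le> F (p + 1)}"

definition cobweb_X :: "(nat \<Rightarrow> nat) \<Rightarrow> (nat \<times> nat) rel" where
  "cobweb_X F =
     {((s, t), (u, v)) | s t u v. (s, t) \<in> cobweb_verts F \<and> (u, v) \<in> cobweb_verts F \<and>
        (t < v \<or> (t = v \<and> s \<le> u))}"

definition cobweb_Y :: "(nat \<Rightarrow> nat) \<Rightarrow> (nat \<times> nat) rel" where
  "cobweb_Y F =
     {((s, t), (u, v)) | s t u v. (s, t) \<in> cobweb_verts F \<and> (u, v) \<in> cobweb_verts F \<and>
        (t < v \<or> (t = v \<and> s \<ge> u))}"

end

theory Submission
  imports Defs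
begin

text \<open>Both \<open>cobweb_X\<close> and \<open>cobweb_Y\<close> are lexicographic orders, level
  first and then position, with the positions reversed in \<open>cobweb_Y\<close>. They agree
  between different levels and are opposite inside a level, so by antisymmetry of \<le> on positions
  their intersection leaves only equality there, which is the cobweb order
  (\<open>cobweb_order_eq_Int\<close>). As no level is empty, a jump over a level can be
  interpolated, so the covering pairs are exactly the edges between consecutive levels
  (\<open>hasse_edges_cobweb_order\<close>).

  The two extensions bound the dimension by 2. A level with two vertices contains an incomparable
  pair, while an intersection of fewer than two linear extensions is total
  (\<open>intersection_of_linear_extensions_less_2_total\<close>), so the dimension is then exactly
  2. If all levels are singletons, the order is a chain of dimension 1; this is why orderability is
  claimed only when some \<open>F n\<close> differs from 1.\<close>

lemma cobweb_verts_iff: "(j, s) \<in> cobweb_verts F \<longleftrightarrow> 1 \<le> j \<and> j \<le> F s"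
  by (auto simp: cobweb_verts_def cobweb_level_def)

lemma cobweb_order_iff:
  "((s, t), (u, v)) \<in> cobweb_order F \<longleftrightarrow>
     (s, t) \<in> cobweb_verts F \<and> (u, v) \<in> cobweb_verts F \<and> (t < v \<or> t = v \<and> s = u)"
  by (simp add: cobweb_order_def)

lemma cobweb_X_iff:
  "((s, t), (u, v)) \<in> cobweb_X F \<longleftrightarrow>
     (s, t) \<in> cobweb_verts F \<and> (u, v) \<in> cobweb_verts F \<and> (t < v \<or> t = v \<and> s \<le> u)"
  by (simp add: cobweb_X_def)

lemma cobweb_Y_iff:
  "((s, t), (u, v)) \<in> cobweb_Y F \<longleftrightarrow>
     (s, t) \<in> cobweb_verts F \<and> (u, v) \<in> cobweb_verts F \<and> (t < v \<or> t = v \<and> u \<le> s)"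
  by (simp add: cobweb_Y_def)

lemma cobweb_edges_iff:
  "((j, p), (q, r)) \<in> cobweb_edges F \<longleftrightarrow>
     (j, p) \<in> cobweb_verts F \<and> (q, r) \<in> cobweb_verts F \<and> r = Suc p"
  by (auto simp: cobweb_edges_def cobweb_verts_iff)

lemma partial_order_cobweb: "partial_order_on (cobweb_verts F) (cobweb_order F)"
  by (auto simp: partial_order_on_def preorder_on_def refl_on_def trans_def antisym_def
      cobweb_order_iff)

lemma linear_extension_cobweb_X:
  "linear_extension (cobweb_verts F) (cobweb_order F) (cobweb_X F)"
  by (auto simp: linear_extension_def linear_order_on_def partial_order_on_def preorder_on_def
      refl_on_def trans_def antisym_def total_on_def cobweb_order_iff cobweb_X_iff)

lemma linear_extension_cobweb_Y:
  "linear_extension (cobweb_verts F) (cobweb_order F) (cobweb_Y F)"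
  by (auto simp: linear_extension_def linear_order_on_def partial_order_on_def preorder_on_def
      refl_on_def trans_def antisym_def total_on_def cobweb_order_iff cobweb_Y_iff)

lemma cobweb_order_eq_Int: "cobweb_order F = cobweb_X F \<inter> cobweb_Y F"
  by (auto simp: cobweb_order_iff cobweb_X_iff cobweb_Y_iff)

lemma hasse_edges_cobweb_order:
  assumes "\<And>n. F n > 0"
  shows "hasse_edges (cobweb_order F) = cobweb_edges F"
proof (rule set_eqI, clarify)
  fix j p q r
  \<comment> \<open>Positivity of \<open>F (Suc p)\<close> puts the vertex \<open>(1, Suc p)\<close>
    on the level just above p, hence strictly between the two given ones.\<close>
  have interpolate: "\<exists>c. c \<noteq> (j, p) \<and> c \<noteq> (q, r) \<and> ((j, p), c) \<in> cobweb_order F \<and>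
      (c, (q, r)) \<in> cobweb_order F"
    if "((j, p), (q, r)) \<in> cobweb_order F" "Suc p < r"
    using that assms[of "Suc p"]
    by (intro exI[of _ "(1, Suc p)"]) (auto simp: cobweb_order_iff cobweb_verts_iff Suc_le_eq)
  show "((j, p), (q, r)) \<in> hasse_edges (cobweb_order F) \<longleftrightarrow> ((j, p), (q, r)) \<in> cobweb_edges F"
  proof
    assume hasse: "((j, p), (q, r)) \<in> hasse_edges (cobweb_order F)"
    \<comment> \<open>Distinct comparable vertices lie on different levels, so p < r; without an
      interpolating vertex this leaves only r = \<open>Suc p\<close>.\<close>
    then have "((j, p), (q, r)) \<in> cobweb_order F" "\<not> Suc p < r" "(j, p) \<noteq> (q, r)"
      using interpolate by (auto simp: hasse_edges_def)
    then show "((j, p), (q, r)) \<in> cobweb_edges F"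
      by (auto simp: cobweb_order_iff cobweb_edges_iff)
  next
    assume "((j, p), (q, r)) \<in> cobweb_edges F"
    then show "((j, p), (q, r)) \<in> hasse_edges (cobweb_order F)"
      by (auto simp: hasse_edges_def cobweb_order_iff cobweb_edges_iff)
  qed
qed

lemma dag_cobweb: "dag (cobweb_verts F) (cobweb_edges F)"
proof -
  \<comment> \<open>Every edge raises the level, so a cycle would make a level smaller than
    itself.\<close>
  have "cobweb_edges F \<subseteq> measure snd"
    by (auto simp: cobweb_edges_iff)
  then have "acyclic (cobweb_edges F)"
    by (rule wf_acyclic[OF wf_subset[OF wf_measure]])
  then show ?thesis
    by (auto simp: dag_def cobweb_edges_iff)
qed

text \<open>The number is left as a cardinality because the two extensions coincide when every level
  is a singleton; it is then 1 instead of 2.\<close>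

lemma intersection_of_linear_extensions_cobweb:
  "intersection_of_linear_extensions (cobweb_verts F) (cobweb_order F)
     (card {cobweb_X F, cobweb_Y F})"
  unfolding intersection_of_linear_extensions_def
proof (intro exI conjI)
  show "cobweb_order F = cobweb_verts F \<times> cobweb_verts F \<inter> \<Inter> {cobweb_X F, cobweb_Y F}"
    by (auto simp: cobweb_order_iff cobweb_X_iff cobweb_Y_iff)
qed (use linear_extension_cobweb_X linear_extension_cobweb_Y in auto)

text \<open>One finite representation suffices for the dimension to exist: the natural numbers are
  well-ordered, so a least size can be chosen.\<close>

lemma ex_has_order_dimension_le:
  assumes "intersection_of_linear_extensions A R n"
  shows "\<exists>s\<le>n. has_order_dimension A R s"
proof (intro exI conjI)
  let ?P = "intersection_of_linear_extensions A R"
  show "(LEAST s. ?P s) \<le> n"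
    using assms by (rule Least_le)
  show "has_order_dimension A R (LEAST s. ?P s)"
    unfolding has_order_dimension_def using LeastI[of ?P, OF assms] not_less_Least by auto
qed

text \<open>The lower bound on the dimension: the empty family yields A \<times> A, and a single
  linear extension yields its own restriction to A, both of which are total.\<close>

lemma intersection_of_linear_extensions_less_2_total:
  assumes "intersection_of_linear_extensions A R s" "s < 2"
  shows "total_on A R"
proof -
  obtain \<L> where \<L>: "finite \<L>" "card \<L> = s" "\<forall>L\<in>\<L>. linear_extension A R L"
    "R = A \<times> A \<inter> \<Inter>\<L>"
    using assms(1) by (auto simp: intersection_of_linear_extensions_def)
  consider "s = 0" | "s = 1"
    using assms(2) by linarith
  then show ?thesis
  proof cases
    case 1
    then show ?thesis
      using \<L> by (auto simp: total_on_def)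
  next
    case 2
    then obtain L where "\<L> = {L}"
      using \<L>(2) card_1_singletonE by blast
    then show ?thesis
      using \<L> by (auto simp: total_on_def linear_extension_def linear_order_on_def)
  qed
qed

text \<open>The vertices \<open>(1, n)\<close> and \<open>(2, n)\<close> serve twice: they are
  ordered oppositely by the two extensions, which are therefore distinct and number exactly 2, and
  they are incomparable, which rules out fewer.\<close>

lemma has_order_dimension_cobweb_2:
  assumes "F n > 1"
  shows "has_order_dimension (cobweb_verts F) (cobweb_order F) 2"
proof -
  have verts: "(1, n) \<in> cobweb_verts F" "(2, n) \<in> cobweb_verts F"
    using assms by (auto simp: cobweb_verts_iff)
  then have "((1, n), (2, n)) \<in> cobweb_X F" "((1, n), (2, n)) \<notin> cobweb_Y F"
    by (auto simp: cobweb_X_iff cobweb_Y_iff)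
  then have "cobweb_X F \<noteq> cobweb_Y F"
    by blast
  then have "intersection_of_linear_extensions (cobweb_verts F) (cobweb_order F) 2"
    using intersection_of_linear_extensions_cobweb[of F] by (simp add: numeral_2_eq_2)
  moreover have "\<not> total_on (cobweb_verts F) (cobweb_order F)"
  proof
    assume "total_on (cobweb_verts F) (cobweb_order F)"
    with verts have "((1, n), (2, n)) \<in> cobweb_order F \<or> ((2, n), (1, n)) \<in> cobweb_order F"
      by (force simp: total_on_def)
    then show False
      by (simp add: cobweb_order_iff)
  qed
  ultimately show ?thesis
    using intersection_of_linear_extensions_less_2_total
    unfolding has_order_dimension_def by blast
qed

theorem theorem4:
  fixes F :: "nat \<Rightarrow> nat"
  assumes "\<And>n. F n > 0" and "F 0 = 1"
  shows "partial_order_on (cobweb_verts F) (cobweb_order F)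
    \<and> hasse_edges (cobweb_order F) = cobweb_edges F
    \<and> linear_extension (cobweb_verts F) (cobweb_order F) (cobweb_X F)
    \<and> linear_extension (cobweb_verts F) (cobweb_order F) (cobweb_Y F)
    \<and> cobweb_order F = cobweb_X F \<inter> cobweb_Y F
    \<and> dag (cobweb_verts F) (cobweb_edges F)
    \<and> (\<exists>s\<le>2. has_order_dimension (cobweb_verts F) (cobweb_order F) s)
    \<and> ((\<exists>n. F n \<noteq> 1) \<longrightarrow> orderable_dag (cobweb_verts F) (cobweb_edges F))"
proof (intro conjI impI)
  have "card {cobweb_X F, cobweb_Y F} \<le> 2"
    by (simp add: card_insert_if)
  then show "\<exists>s\<le>2. has_order_dimension (cobweb_verts F) (cobweb_order F) s"
    using ex_has_order_dimension_le[OF intersection_of_linear_extensions_cobweb] order_trans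
    by blast
next
  assume "\<exists>n. F n \<noteq> 1"
  then obtain n where "F n \<noteq> 1" ..
  with assms(1)[of n] have "F n > 1"
    by linarith
  then show "orderable_dag (cobweb_verts F) (cobweb_edges F)"
    unfolding orderable_dag_def
    by (intro conjI exI[of _ "cobweb_order F"] dag_cobweb partial_order_cobweb
        has_order_dimension_cobweb_2 hasse_edges_cobweb_order assms(1))
qed (fact partial_order_cobweb hasse_edges_cobweb_order[OF assms(1)] linear_extension_cobweb_X
    linear_extension_cobweb_Y cobweb_order_eq_Int dag_cobweb)+

end
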